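(* Let $M$ be a subspace of a (real) Banach space $(E,\|\cdot\|)$. Then $M$ has property-U in $E$ if and only if $M$, as a subspace of $(E,w)$, has the property-SNP with respect to the generating family $\mathcal{F}=\{\rho_F: F\subseteq B_{E^*}\text{ finite}\}$, where $\rho_F(x)=\max\{|f(x)|:f\in F\}$ for $x\in E$.
   Context: $(E,w)$ is $E$ with its weak topology, which is induced by the directed family $\mathcal{F}$; $B_{E^*}$ is the closed unit ball of the dual $E^*$. The dual of $(E,w)$ is $E^*$ and the dual of $M$ is $M^*$. $M$ has property-U in $E$ if each $f\in M^*$ has a unique norm-preserving extension in $E^*$. For seminorms, $\rho\succeq\mu$ means $\rho(x)\ge\mu(x)$ for all $x$. For $\rho\in\mathcal{F}$, $f\in E^*$, $h\in M^*$: $\chi_\rho^E(f)=\sup\{|f(x)|:x\in E,\rho(x)\le1\}\in[0,\infty]$ and $\chi_\rho^M(h)=\sup\{|h(y)|:y\in M,\rho(y)\le1\}\in[0,\infty]$. For $h\in M^*$ and $\rho\in\mathcal{F}$ with $\chi_\rho^M(h)<\infty$, a Hahn-Banach extension (HBE) of the pair $(h,\rho)$ is an $\widetilde h\in E^*$ with $\widetilde h|_M=h$ and $\chi_\rho^E(\widetilde h)=\chi_\rho^M(h)$. $M$ has property-SNP (with respect to $\mathcal{F}$) if for every $h\in M^*$ there are $\mu\in\mathcal{F}$ with $\chi_\mu^M(h)<\infty$ and $\widetilde h\in E^*$ such that for every $\rho\in\mathcal{F}$ with $\rho\succeq\mu$, $\widetilde h$ is the unique HBE of $(h,\rho)$ (the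 same $\widetilde h$ for all these $\rho$). *)

theory Defs
  imports "HOL-Analysis.Analysis"
begin

text \<open>
  The dual \<open>E\<^sup>*\<close> is the type \<open>'a \<Rightarrow>\<^sub>L real\<close>. Elements of \<open>M\<^sup>*\<close> are represented by functions on the
  whole space of which only the values on \<open>M\<close> matter: every notion below is insensitive to the
  values outside \<open>M\<close>.
\<close>

definition dual_on :: "'a::real_normed_vector set \<Rightarrow> ('a \<Rightarrow> real) set" where
  "dual_on M = {h. (\<forall>x\<in>M. \<forall>y\<in>M. h (x + y) = h x + h y) \<and>
                   (\<forall>c. \<forall>x\<in>M. h (c *\<^sub>R x) = c * h x) \<and>
                   (\<exists>K. \<forall>x\<in>M. \<bar>h x\<bar> \<le> K * norm x)}"

definition norm_on :: "'a::real_normed_vector set \<Rightarrow> ('a \<Rightarrow> real) \<Rightarrow> real" where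
  "norm_on M h = (SUP x\<in>{x\<in>M. norm x \<le> 1}. \<bar>h x\<bar>)"

definition property_U :: "'a::real_normed_vector set \<Rightarrow> bool" where
  "property_U M \<longleftrightarrow>
     (\<forall>h\<in>dual_on M. \<exists>!f :: 'a \<Rightarrow>\<^sub>L real.
        (\<forall>x\<in>M. blinfun_apply f x = h x) \<and> norm f = norm_on M h)"

definition chi :: "('a \<Rightarrow> real) \<Rightarrow> 'a set \<Rightarrow> ('a \<Rightarrow> real) \<Rightarrow> ennreal" where
  "chi \<rho> S h = (SUP x\<in>{x\<in>S. \<rho> x \<le> 1}. ennreal \<bar>h x\<bar>)"

definition is_HBE ::
  "'a::real_normed_vector set \<Rightarrow> ('a \<Rightarrow> real) \<Rightarrow> ('a \<Rightarrow> real) \<Rightarrow> ('a \<Rightarrow>\<^sub>L real) \<Rightarrow> bool" where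
  "is_HBE M h \<rho> f \<longleftrightarrow>
     chi \<rho> M h < \<infinity> \<and>
     (\<forall>x\<in>M. blinfun_apply f x = h x) \<and>
     chi \<rho> UNIV (blinfun_apply f) = chi \<rho> M h"

text \<open>
  The dual of the locally convex space generated by \<open>\<F>\<close> is taken to be the norm dual, so this is
  meant for families \<open>\<F>\<close> that generate the weak topology, as \<open>weak_seminorms\<close> does. The relation
  \<open>\<mu> \<le> \<rho>\<close> is the pointwise order on functions.
\<close>

definition property_SNP ::
  "('a::real_normed_vector \<Rightarrow> real) set \<Rightarrow> 'a set \<Rightarrow> bool" where
  "property_SNP \<F> M \<longleftrightarrow>
     (\<forall>h\<in>dual_on M. \<exists>\<mu>\<in>\<F>. chi \<mu> M h < \<infinity> \<and>
        (\<exists>f. \<forall>\<rho>\<in>\<F>. \<mu> \<le> \<rho> \<longrightarrow>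
           is_HBE M h \<rho> f \<and> (\<forall>g. is_HBE M h \<rho> g \<longrightarrow> g = f)))"

definition seminorm_of :: "('a::real_normed_vector \<Rightarrow>\<^sub>L real) set \<Rightarrow> 'a \<Rightarrow> real" where
  "seminorm_of F x = Max ((\<lambda>f. \<bar>blinfun_apply f x\<bar>) ` F)"

text \<open>
  The empty set is left out because \<open>Max {}\<close> is unspecified. With the convention that its maximum
  is \<open>0\<close> the family would be the same, since \<open>F = {0}\<close> yields the zero seminorm.
\<close>

definition weak_seminorms :: "('a::real_normed_vector \<Rightarrow> real) set" where
  "weak_seminorms = {seminorm_of F | F. finite F \<and> F \<noteq> {} \<and> F \<subseteq> cball 0 1}"

end

theory Submission imports Defs begin

text \<open>
  Every \<open>\<rho>\<close> in the family is dominated by the norm, so \<open>\<chi>\<^sub>\<rho>\<close> is at least the dual norm. If moreover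
  \<open>g\<close> is a norm-preserving extension of \<open>h\<close> and \<open>\<rho>\<close> dominates \<open>\<bar>g\<bar> / \<parallel>g\<parallel>\<close>, then \<open>\<chi>\<^sub>\<rho>\<close> and the dual
  norm agree on both \<open>h\<close> and \<open>g\<close>, and the Hahn-Banach extensions of \<open>(h, \<rho>)\<close> are exactly the
  norm-preserving extensions of \<open>h\<close>. Adjoining the normalised functionals to the finite set that
  defines \<open>\<rho>\<close> reaches this situation; the norm-preserving extension that property-U asks for
  comes from the Hahn-Banach theorem.
\<close>

section \<open>The Hahn-Banach theorem\<close>

text \<open>
  Partial linear functionals are subspaces \<open>A\<close> of \<open>'a \<times> real\<close>, read as graphs; the bound
  \<open>r \<le> p x\<close> on \<open>A\<close> already forces \<open>A\<close> to be single-valued, since \<open>p 0 = 0\<close>.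
\<close>

lemma dominated_graph_extend:
  fixes A :: "('a::real_vector \<times> real) set" and x0 :: 'a
  assumes A: "subspace A" and dom: "\<And>x r. (x, r) \<in> A \<Longrightarrow> r \<le> p x"
    and add: "\<And>x y. p (x + y) \<le> p x + p y"
    and scale: "\<And>k x. k > 0 \<Longrightarrow> p (k *\<^sub>R x) = k * p x"
  obtains a where "\<And>x r. (x, r) \<in> span (insert (x0, a) A) \<Longrightarrow> r \<le> p x"
proof -
  \<comment> \<open>A value \<open>a\<close> at \<open>x0\<close> is admissible iff it lies above
    every \<open>s - p (y - x0)\<close> and below every \<open>p (z + x0) - t\<close>, for pairs in
    \<open>A\<close>. \<open>key\<close> says that each lower bound is below each upper bound, so
    the supremum of the lower bounds will do.\<close>
  define L where "L = (\<lambda>(y, s). s - p (y - x0)) ` A"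
  have key: "s - p (y - x0) \<le> p (z + x0) - t" if "(y, s) \<in> A" "(z, t) \<in> A" for y s z t
  proof -
    have "(y + z, s + t) \<in> A" using subspace_add[OF A that] by simp
    then have "s + t \<le> p (y + z)" by (rule dom)
    also have "\<dots> \<le> p (y - x0) + p (z + x0)" using add[of "y - x0" "z + x0"] by simp
    finally show ?thesis by simp
  qed
  have zero: "(0, 0) \<in> A" using subspace_0[OF A] by (simp add: zero_prod_def)
  have bdd: "bdd_above L" unfolding L_def using key[OF _ zero] by (intro bdd_aboveI) auto
  have low: "s - p (y - x0) \<le> Sup L" if "(y, s) \<in> A" for y s
    using that by (intro cSup_upper[OF _ bdd]) (auto simp: L_def intro!: image_eqI[of _ _ "(y, s)"])
  have up: "Sup L \<le> p (z + x0) - t" if "(z, t) \<in> A" for z t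
    using that zero key by (intro cSup_least) (auto simp: L_def)
  show ?thesis
  proof (rule that)
    fix x r assume "(x, r) \<in> span (insert (x0, Sup L) A)"
    then obtain k where k: "(x - k *\<^sub>R x0, r - k * Sup L) \<in> A"
      unfolding span_insert span_eq_iff[THEN iffD2, OF A] by auto
    \<comment> \<open>Rescaling reduces the coefficient of \<open>x0\<close> to 1 or -1. For
      \<open>k > 0\<close>, division by \<open>k\<close> writes the vector as \<open>z + x0\<close>,
      where \<open>up\<close> applies; for \<open>k < 0\<close>, division by \<open>-k\<close>
      writes it as \<open>y - x0\<close>, where \<open>low\<close> applies.\<close>
    have kA: "(c *\<^sub>R (x - k *\<^sub>R x0), c * (r - k * Sup L)) \<in> A" for c
      using subspace_scale[OF A k, of c] by simp
    consider "k = 0" | "k > 0" | "k < 0" by linarith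
    then show "r \<le> p x"
    proof cases
      case 1 then show ?thesis using dom[OF k] by simp
    next
      case 2
      have "(1/k) *\<^sub>R (x - k *\<^sub>R x0) + x0 = (1/k) *\<^sub>R x" using 2 by (simp add: algebra_simps)
      then have "Sup L \<le> (1/k) * p x - (1/k) * (r - k * Sup L)"
        using up[OF kA[of "1/k"]] scale[of "1/k" x] 2 by simp
      then have "(1/k) * r \<le> (1/k) * p x" using 2 by (simp add: field_simps)
      then show ?thesis using 2 by (simp add: divide_le_cancel)
    next
      case 3
      have "(-1/k) *\<^sub>R (x - k *\<^sub>R x0) - x0 = (-1/k) *\<^sub>R x" using 3 by (simp add: algebra_simps)
      then have "(-1/k) * (r - k * Sup L) - (-1/k) * p x \<le> Sup L"
        using low[OF kA[of "-1/k"]] scale[of "-1/k" x] 3 by (simp add: divide_less_0_iff)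
      then have "(-1/k) * r \<le> (-1/k) * p x" using 3 by (simp add: field_simps)
      then show ?thesis using 3 by (simp add: divide_le_cancel)
    qed
  qed
qed

text \<open>Zorn's lemma yields a maximal dominated subspace containing the graph of
  \<open>h\<close>. One-step extension shows that it has a pair over every vector, so it is the
  graph of the functional sought.\<close>

theorem hahn_banach_sublinear:
  fixes M :: "'a::real_vector set"
  assumes M: "subspace M"
    and h_add: "\<And>x y. x \<in> M \<Longrightarrow> y \<in> M \<Longrightarrow> h (x + y) = h x + h y"
    and h_scale: "\<And>c x. x \<in> M \<Longrightarrow> h (c *\<^sub>R x) = c * h x"
    and dom: "\<And>x. x \<in> M \<Longrightarrow> h x \<le> p x"
    and add: "\<And>x y. p (x + y) \<le> p x + p y"
    and scale: "\<And>k x. k > 0 \<Longrightarrow> p (k *\<^sub>R x) = k * p x"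
  obtains f :: "'a \<Rightarrow> real"
  where "linear f" "\<And>x. x \<in> M \<Longrightarrow> f x = h x" "\<And>x. f x \<le> p x"
proof -
  define G where "G = (\<lambda>x. (x, h x)) ` M"
  define P where "P = {A. subspace A \<and> G \<subseteq> A \<and> (\<forall>(x, r) \<in> A. r \<le> p x)}"
  have "h 0 = 0" using h_scale[OF subspace_0[OF M], of 0] by simp
  then have "subspace G" unfolding G_def
    using subspace_0[OF M] subspace_add[OF M] subspace_scale[OF M]
    by (auto simp: subspace_def zero_prod_def h_add h_scale image_iff)
  then have GP: "G \<in> P" using dom by (auto simp: P_def G_def)
  \<comment> \<open>The empty chain is treated apart: its union is empty and does not contain
    \<open>G\<close>, so \<open>G\<close> itself serves as the upper bound.\<close>
  have chain: "\<exists>U\<in>P. \<forall>X\<in>C. X \<subseteq> U" if C: "subset.chain P C" for C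
  proof (cases "C = {}")
    case True then show ?thesis using GP by blast
  next
    case False
    have "\<Union>C \<in> P"
    proof -
      have CP: "C \<subseteq> P" and lin: "\<And>X Y. X \<in> C \<Longrightarrow> Y \<in> C \<Longrightarrow> X \<subseteq> Y \<or> Y \<subseteq> X"
        using C by (auto simp: subset_chain_def)
      have sub: "subspace X" if "X \<in> C" for X using CP that by (auto simp: P_def)
      have "subspace (\<Union>C)" unfolding subspace_def
      proof (intro conjI ballI allI)
        show "0 \<in> \<Union>C" using False sub subspace_0 by blast
        show "c *\<^sub>R x \<in> \<Union>C" if "x \<in> \<Union>C" for c x using that sub subspace_scale by blast
        show "x + y \<in> \<Union>C" if xy: "x \<in> \<Union>C" "y \<in> \<Union>C" for x y
        proof -
          obtain X Y where "X \<in> C" "Y \<in> C" "x \<in> X" "y \<in> Y" using xy by blast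
          then obtain Z where "Z \<in> C" "x \<in> Z" "y \<in> Z" using lin by blast
          then show ?thesis using sub subspace_add by blast
        qed
      qed
      moreover have "G \<subseteq> \<Union>C" using False CP by (auto simp: P_def)
      moreover have "\<forall>(x, r) \<in> \<Union>C. r \<le> p x" using CP by (fastforce simp: P_def)
      ultimately show ?thesis by (simp add: P_def)
    qed
    then show ?thesis by blast
  qed
  obtain A where AP: "A \<in> P" and max: "\<And>X. X \<in> P \<Longrightarrow> A \<subseteq> X \<Longrightarrow> X = A"
    using subset_Zorn[OF chain] by blast
  have A: "subspace A" and GA: "G \<subseteq> A" and Adom: "\<And>x r. (x, r) \<in> A \<Longrightarrow> r \<le> p x"
    using AP by (auto simp: P_def)
  have total: "\<exists>r. (x, r) \<in> A" for x
  proof -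
    obtain a where a: "\<And>y r. (y, r) \<in> span (insert (x, a) A) \<Longrightarrow> r \<le> p y"
      using dominated_graph_extend[OF A Adom add scale, where ?x0.0 = x] by blast
    have sup: "A \<subseteq> span (insert (x, a) A)" using span_superset by blast
    then have "span (insert (x, a) A) \<in> P" using a GA subspace_span by (auto simp: P_def)
    then have "span (insert (x, a) A) = A" using max sup by blast
    then show ?thesis using span_base[of "(x, a)" "insert (x, a) A"] by auto
  qed
  \<comment> \<open>Homogeneity with factor 2 reads \<open>p 0 = 2 * p 0\<close>. Two values over
    one point then differ by some \<open>d\<close> with \<open>(0, d)\<close> and
    \<open>(0, - d)\<close> in \<open>A\<close>, so \<open>d\<close> and \<open>- d\<close> are both
    at most 0.\<close>
  have p0: "p 0 = 0" using scale[of 2 0] by simp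
  have unique: "r = s" if "(x, r) \<in> A" "(x, s) \<in> A" for x r s
    using Adom[of 0 "r - s"] Adom[of 0 "s - r"] subspace_diff[OF A that] subspace_diff[OF A that(2,1)]
    by (simp add: p0)
  obtain f where f: "\<And>x. (x, f x) \<in> A" using total by metis
  show ?thesis
  proof
    show "linear f"
    proof (rule linearI)
      show "f (x + y) = f x + f y" for x y
        \<comment> \<open>Both sides are values of \<open>A\<close> over the same point, as
          \<open>A\<close> is a subspace; single-valuedness equates them.\<close>
        using subspace_add[OF A f f, of x y] by (intro unique[OF f]) simp
      show "f (c *\<^sub>R x) = c *\<^sub>R f x" for c x
        using subspace_scale[OF A f, of c x] by (intro unique[OF f]) simp
    qed
    show "f x = h x" if "x \<in> M" for x using GA that by (intro unique[OF f]) (auto simp: G_def)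
    show "f x \<le> p x" for x by (rule Adom[OF f])
  qed
qed

section \<open>Dual norms and norm-preserving extensions\<close>

lemma dual_onD:
  assumes "h \<in> dual_on M"
  shows "x \<in> M \<Longrightarrow> y \<in> M \<Longrightarrow> h (x + y) = h x + h y" "x \<in> M \<Longrightarrow> h (c *\<^sub>R x) = c * h x"
  using assms by (auto simp: dual_on_def)

lemma blinfun_in_dual_on: "blinfun_apply f \<in> dual_on UNIV"
  unfolding dual_on_def using norm_blinfun[of f]
  by (auto simp: blinfun.add_right blinfun.scaleR_right)

lemma bdd_above_dual_on:
  assumes "h \<in> dual_on M"
  shows "bdd_above ((\<lambda>x. \<bar>h x\<bar>) ` {x \<in> M. norm x \<le> 1})"
proof -
  obtain K where K: "\<And>x. x \<in> M \<Longrightarrow> \<bar>h x\<bar> \<le> K * norm x"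
    using assms unfolding dual_on_def by blast
  show ?thesis
  proof (rule bdd_aboveI2)
    fix x assume "x \<in> {x \<in> M. norm x \<le> 1}"
    then have x: "x \<in> M" "norm x \<le> 1" by auto
    \<comment> \<open>The absolute value is taken because \<open>K\<close> may be negative when
      \<open>M\<close> contains only 0.\<close>
    have "K * norm x \<le> \<bar>K\<bar> * 1" using x(2) by (intro mult_mono) auto
    then show "\<bar>h x\<bar> \<le> \<bar>K\<bar>" using K[OF x(1)] by simp
  qed
qed

lemma abs_le_norm_on:
  assumes M: "subspace M" and h: "h \<in> dual_on M" and x: "x \<in> M"
  shows "\<bar>h x\<bar> \<le> norm_on M h * norm x"
proof (cases "x = 0")
  case True
  then show ?thesis using dual_onD(2)[OF h x, of 0] by simp
next
  case False
  have "\<bar>h ((1 / norm x) *\<^sub>R x)\<bar> \<le> norm_on M h" unfolding norm_on_def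
    using False subspace_scale[OF M x] by (intro cSUP_upper[OF _ bdd_above_dual_on[OF h]]) auto
  then show ?thesis using False by (simp add: dual_onD(2)[OF h x] abs_mult field_simps)
qed

lemma norm_on_le:
  assumes "subspace M" and "\<And>x. x \<in> M \<Longrightarrow> norm x \<le> 1 \<Longrightarrow> \<bar>h x\<bar> \<le> c"
  shows "norm_on M h \<le> c"
  unfolding norm_on_def using assms subspace_0[OF assms(1)] by (intro cSUP_least) force+

lemma norm_on_nonneg:
  assumes "subspace M" and "h \<in> dual_on M"
  shows "0 \<le> norm_on M h"
  unfolding norm_on_def using subspace_0[OF assms(1)]
  by (intro cSUP_upper2[OF bdd_above_dual_on[OF assms(2)], of 0]) auto

text \<open>This lets the facts about \<open>norm_on\<close>, used with \<open>UNIV\<close> for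
  \<open>M\<close>, speak about the norm of the dual space.\<close>

lemma norm_on_UNIV_blinfun: "norm_on UNIV (blinfun_apply f) = norm f"
proof (rule antisym)
  show "norm_on UNIV (blinfun_apply f) \<le> norm f"
  proof (rule norm_on_le)
    fix x :: 'a assume "norm x \<le> 1"
    then show "\<bar>blinfun_apply f x\<bar> \<le> norm f"
      using norm_blinfun[of f x] mult_left_le[of "norm x" "norm f"] by simp
  qed simp
  show "norm f \<le> norm_on UNIV (blinfun_apply f)"
    using abs_le_norm_on[OF subspace_UNIV blinfun_in_dual_on, of _ f]
      norm_on_nonneg[OF subspace_UNIV blinfun_in_dual_on, of f]
    by (intro norm_blinfun_bound) auto
qed

lemma norm_on_le_norm_extension:
  assumes "subspace M" and "\<And>x. x \<in> M \<Longrightarrow> blinfun_apply g x = h x"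
  shows "norm_on M h \<le> norm g"
proof (rule norm_on_le[OF assms(1)])
  fix x assume "x \<in> M" "norm x \<le> 1"
  then show "\<bar>h x\<bar> \<le> norm g"
    using norm_blinfun[of g x] mult_left_le[of "norm x" "norm g"] assms(2)[of x] by simp
qed

theorem hahn_banach_norm_preserving:
  fixes M :: "'a::real_normed_vector set"
  assumes M: "subspace M" and h: "h \<in> dual_on M"
  obtains f :: "'a \<Rightarrow>\<^sub>L real"
  where "\<And>x. x \<in> M \<Longrightarrow> blinfun_apply f x = h x" "norm f = norm_on M h"
proof -
  note nn = norm_on_nonneg[OF M h]
  obtain f where lin: "linear f" and ext: "\<And>x. x \<in> M \<Longrightarrow> f x = h x"
    and le: "\<And>x. f x \<le> norm_on M h * norm x"
  proof (rule hahn_banach_sublinear[OF M, of h "\<lambda>x. norm_on M h * norm x"])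
    show "h x \<le> norm_on M h * norm x" if "x \<in> M" for x using abs_le_norm_on[OF M h that] by simp
    show "norm_on M h * norm (x + y) \<le> norm_on M h * norm x + norm_on M h * norm y" for x y
      using mult_left_mono[OF norm_triangle_ineq nn] by (simp add: distrib_left)
  qed (use dual_onD[OF h] in auto)
  \<comment> \<open>The dominating functional is even, so the one-sided bound at \<open>x\<close>
    and \<open>- x\<close> gives a two-sided one.\<close>
  have abs: "\<bar>f x\<bar> \<le> norm_on M h * norm x" for x
    using le[of x] le[of "- x"] linear_neg[OF lin, of x] by simp
  have "bounded_linear f"
    using abs by (intro bounded_linear_intro[of _ "norm_on M h"])
      (auto simp: linear_add[OF lin] linear_cmul[OF lin] mult.commute)
  then have app: "blinfun_apply (Blinfun f) = f" by (rule bounded_linear_Blinfun_apply)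
  show ?thesis
  proof
    show ext': "blinfun_apply (Blinfun f) x = h x" if "x \<in> M" for x using ext that app by simp
    show "norm (Blinfun f) = norm_on M h"
    proof (rule antisym)
      show "norm (Blinfun f) \<le> norm_on M h" using nn abs by (intro norm_blinfun_bound) (auto simp: app)
    qed (rule norm_on_le_norm_extension[OF M ext'])
  qed
qed

section \<open>Seminorms dominated by the norm\<close>

lemma chi_le:
  assumes "c \<ge> 0" and "\<And>x. x \<in> S \<Longrightarrow> \<bar>h x\<bar> \<le> c * \<rho> x"
  shows "chi \<rho> S h \<le> ennreal c"
  unfolding chi_def
proof (rule SUP_least)
  fix x assume "x \<in> {x \<in> S. \<rho> x \<le> 1}"
  then show "ennreal \<bar>h x\<bar> \<le> ennreal c"
    using assms(2)[of x] mult_left_le[of "\<rho> x" c] assms(1) by (intro ennreal_leI) auto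
qed

text \<open>The unit ball of the norm lies inside that of \<open>\<rho>\<close>, so
  \<open>chi\<close> takes its supremum over a larger set.\<close>

lemma norm_on_le_chi:
  assumes M: "subspace M" and \<rho>: "\<And>x. \<rho> x \<le> norm x"
  shows "ennreal (norm_on M h) \<le> chi \<rho> M h"
proof (cases "chi \<rho> M h")
  case (real c)
  have "norm_on M h \<le> c"
  proof (rule norm_on_le[OF M])
    fix x assume "x \<in> M" "norm x \<le> 1"
    then have "ennreal \<bar>h x\<bar> \<le> chi \<rho> M h"
      unfolding chi_def using \<rho>[of x] by (intro SUP_upper) auto
    then show "\<bar>h x\<bar> \<le> c" using real by simp
  qed
  then show ?thesis using real by (simp add: ennreal_leI)
qed simp

text \<open>\<open>dom\<close> bounds \<open>chi\<close> by \<open>norm g\<close> on the whole space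
  and hence on \<open>M\<close>, while \<open>norm_on_le_chi\<close> gives the reverse bounds; so
  both values of \<open>chi\<close> equal the common norm.\<close>

lemma
  assumes M: "subspace M" and \<rho>: "\<And>x. \<rho> x \<le> norm x"
    and ext: "\<And>x. x \<in> M \<Longrightarrow> blinfun_apply g x = h x" and norm: "norm g = norm_on M h"
    and dom: "\<And>x. \<bar>blinfun_apply g x\<bar> \<le> norm g * \<rho> x"
  shows chi_eq_norm_on: "chi \<rho> M h = ennreal (norm_on M h)"
    and norm_preserving_is_HBE: "is_HBE M h \<rho> g"
proof -
  show *: "chi \<rho> M h = ennreal (norm_on M h)"
  proof (rule antisym)
    show "chi \<rho> M h \<le> ennreal (norm_on M h)"
      using dom ext unfolding norm[symmetric] by (intro chi_le) (auto simp flip: ext)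
  qed (rule norm_on_le_chi[OF M \<rho>])
  have "chi \<rho> UNIV (blinfun_apply g) = ennreal (norm g)"
  proof (rule antisym)
    show "chi \<rho> UNIV (blinfun_apply g) \<le> ennreal (norm g)" using dom by (intro chi_le) auto
    show "ennreal (norm g) \<le> chi \<rho> UNIV (blinfun_apply g)"
      using norm_on_le_chi[OF subspace_UNIV \<rho>, of "blinfun_apply g"]
      by (simp add: norm_on_UNIV_blinfun)
  qed
  then show "is_HBE M h \<rho> g" using * ext norm by (simp add: is_HBE_def)
qed

text \<open>The norm of \<open>g\<close> is at most its \<open>chi\<close> over the whole space,
  which equals \<open>chi \<rho> M h\<close> and so \<open>norm_on M h\<close>. The other inequality
  holds for any extension.\<close>

lemma is_HBE_norm_preserving:
  assumes M: "subspace M" and h: "h \<in> dual_on M" and \<rho>: "\<And>x. \<rho> x \<le> norm x"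
    and chi: "chi \<rho> M h = ennreal (norm_on M h)" and g: "is_HBE M h \<rho> g"
  shows "norm g = norm_on M h"
proof (rule antisym)
  have "ennreal (norm g) \<le> ennreal (norm_on M h)"
    using norm_on_le_chi[OF subspace_UNIV \<rho>, of "blinfun_apply g"] g chi
    by (simp add: is_HBE_def norm_on_UNIV_blinfun)
  then show "norm g \<le> norm_on M h" using norm_on_nonneg[OF M h] by simp
  show "norm_on M h \<le> norm g"
    using g by (intro norm_on_le_norm_extension[OF M]) (auto simp: is_HBE_def)
qed

lemma seminorm_of_mono:
  "finite G \<Longrightarrow> F \<noteq> {} \<Longrightarrow> F \<subseteq> G \<Longrightarrow> seminorm_of F \<le> seminorm_of G"
  unfolding seminorm_of_def le_fun_def by (intro allI Max_mono) auto

lemma weak_seminorm_le_norm: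
  assumes "\<rho> \<in> weak_seminorms"
  shows "\<rho> x \<le> norm x"
proof -
  obtain F where F: "\<rho> = seminorm_of F" "finite F" "F \<noteq> {}" "F \<subseteq> cball 0 1"
    using assms by (auto simp: weak_seminorms_def)
  have "\<bar>blinfun_apply f x\<bar> \<le> norm x" if "f \<in> F" for f
  proof -
    have "norm f \<le> 1" using F that by auto
    then show ?thesis
      using norm_blinfun[of f x] mult_right_mono[of "norm f" 1 "norm x"] by simp
  qed
  then show ?thesis using F by (simp add: seminorm_of_def)
qed

text \<open>For \<open>f = 0\<close> the adjoined functional is \<open>0\<close>, as \<open>inverse 0 = 0\<close>, and the bound still holds.\<close>

lemma normalised_le_seminorm_of:
  assumes "finite F" and "f /\<^sub>R norm f \<in> F"
  shows "\<bar>blinfun_apply f x\<bar> \<le> norm f * seminorm_of F x"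
proof -
  have "\<bar>blinfun_apply f x\<bar> = norm f * \<bar>blinfun_apply (f /\<^sub>R norm f) x\<bar>"
    by (cases "f = 0") (auto simp: blinfun.scaleR_left abs_mult)
  also have "\<dots> \<le> norm f * seminorm_of F x"
    unfolding seminorm_of_def using assms by (intro mult_left_mono Max_ge) auto
  finally show ?thesis .
qed

lemma normalised_in_cball: "f /\<^sub>R norm f \<in> cball (0 :: 'a::real_normed_vector) 1"
  by (cases "f = 0") auto

section \<open>The two implications\<close>

lemma property_U_imp_SNP:
  assumes M: "subspace M" and U: "property_U M"
  shows "property_SNP weak_seminorms M"
  unfolding property_SNP_def
proof (intro ballI)
  fix h assume h: "h \<in> dual_on M"
  then obtain f where ext: "\<And>x. x \<in> M \<Longrightarrow> blinfun_apply f x = h x" and norm: "norm f = norm_on M h"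
    and unique: "\<And>g. \<forall>x\<in>M. blinfun_apply g x = h x \<Longrightarrow> norm g = norm_on M h \<Longrightarrow> g = f"
    using U unfolding property_U_def by metis
  \<comment> \<open>This seminorm satisfies \<open>\<bar>f x\<bar> \<le> norm f * \<mu> x\<close>,
    and the bound passes to every larger \<open>\<rho>\<close>. One choice of \<open>\<mu>\<close>
    thus handles all of them with the same \<open>f\<close>.\<close>
  define \<mu> where "\<mu> = seminorm_of {f /\<^sub>R norm f}"
  have \<mu>: "\<mu> \<in> weak_seminorms"
    unfolding \<mu>_def weak_seminorms_def using normalised_in_cball[of f] by blast
  have dom: "\<bar>blinfun_apply f x\<bar> \<le> norm f * \<rho> x" if "\<mu> \<le> \<rho>" for \<rho> x
  proof -
    have "norm f * \<mu> x \<le> norm f * \<rho> x" using that by (intro mult_left_mono) (auto simp: le_fun_def)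
    then show ?thesis
      using normalised_le_seminorm_of[of "{f /\<^sub>R norm f}" f x] by (simp add: \<mu>_def)
  qed
  have "is_HBE M h \<rho> f \<and> (\<forall>g. is_HBE M h \<rho> g \<longrightarrow> g = f)"
    if \<rho>: "\<rho> \<in> weak_seminorms" "\<mu> \<le> \<rho>" for \<rho>
  proof -
    note le = weak_seminorm_le_norm[OF \<rho>(1)]
    note props = M le ext norm dom[OF \<rho>(2)]
    have "g = f" if "is_HBE M h \<rho> g" for g
      using is_HBE_norm_preserving[OF M h le chi_eq_norm_on[OF props] that] that
      by (intro unique) (auto simp: is_HBE_def)
    then show ?thesis using norm_preserving_is_HBE[OF props] by blast
  qed
  \<comment> \<open>This is the case of \<open>\<mu>\<close> itself: being a Hahn-Banach extension
    includes finiteness.\<close>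
  moreover have "chi \<mu> M h < \<infinity>"
    using calculation[OF \<mu>] by (auto simp: is_HBE_def)
  ultimately show "\<exists>\<mu>\<in>weak_seminorms. chi \<mu> M h < \<infinity> \<and> (\<exists>f. \<forall>\<rho>\<in>weak_seminorms. \<mu> \<le> \<rho> \<longrightarrow>
      is_HBE M h \<rho> f \<and> (\<forall>g. is_HBE M h \<rho> g \<longrightarrow> g = f))"
    using \<mu> by blast
qed

lemma property_SNP_imp_U:
  assumes M: "subspace M" and SNP: "property_SNP weak_seminorms M"
  shows "property_U M"
  unfolding property_U_def
proof (intro ballI ex_ex1I)
  fix h assume h: "h \<in> dual_on M"
  show "\<exists>f. (\<forall>x\<in>M. blinfun_apply f x = h x) \<and> norm f = norm_on M h"
    using hahn_banach_norm_preserving[OF M h] by metis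
  fix g\<^sub>1 g\<^sub>2
  assume g\<^sub>1: "(\<forall>x\<in>M. blinfun_apply g\<^sub>1 x = h x) \<and> norm g\<^sub>1 = norm_on M h"
    and g\<^sub>2: "(\<forall>x\<in>M. blinfun_apply g\<^sub>2 x = h x) \<and> norm g\<^sub>2 = norm_on M h"
  obtain \<mu> f where \<mu>: "\<mu> \<in> weak_seminorms"
    and f: "\<And>\<rho> g. \<rho> \<in> weak_seminorms \<Longrightarrow> \<mu> \<le> \<rho> \<Longrightarrow> is_HBE M h \<rho> g \<Longrightarrow> g = f"
    using SNP h unfolding property_SNP_def by metis
  obtain F where F: "\<mu> = seminorm_of F" "finite F" "F \<noteq> {}" "F \<subseteq> cball 0 1"
    using \<mu> by (auto simp: weak_seminorms_def)
  \<comment> \<open>Keeping \<open>F\<close> puts the new seminorm above \<open>\<mu>\<close>;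
    adjoining both normalised functionals makes \<open>g\<^sub>1\<close> and
    \<open>g\<^sub>2\<close> Hahn-Banach extensions for one and the same seminorm, where uniqueness
    identifies both with \<open>f\<close>.\<close>
  define G where "G = {g\<^sub>1 /\<^sub>R norm g\<^sub>1, g\<^sub>2 /\<^sub>R norm g\<^sub>2} \<union> F"
  have G: "finite G" "F \<subseteq> G" using F by (auto simp: G_def)
  have w: "seminorm_of G \<in> weak_seminorms"
    unfolding weak_seminorms_def using F G normalised_in_cball[of g\<^sub>1] normalised_in_cball[of g\<^sub>2]
    by (intro CollectI exI[of _ G]) (auto simp: G_def simp del: mem_cball)
  have "is_HBE M h (seminorm_of G) g" if "g \<in> {g\<^sub>1, g\<^sub>2}" for g
  proof (rule norm_preserving_is_HBE[OF M weak_seminorm_le_norm[OF w]])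
    show "\<bar>blinfun_apply g x\<bar> \<le> norm g * seminorm_of G x" for x
      using that by (intro normalised_le_seminorm_of G) (auto simp: G_def)
  qed (use that g\<^sub>1 g\<^sub>2 in auto)
  then show "g\<^sub>1 = g\<^sub>2"
    using f[OF w] seminorm_of_mono[OF G(1) F(3) G(2)] F(1) by blast
qed

theorem theorem2p14:
  fixes M :: "'a::banach set"
  assumes "subspace M"
  shows "property_U M \<longleftrightarrow> property_SNP weak_seminorms M"
  using property_U_imp_SNP[OF assms] property_SNP_imp_U[OF assms] by blast

end
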